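(* Let $G$ be a connected graph with $n\ge2$ vertices and $m$ edges, let $\mu_1,\dots,\mu_n$ be the eigenvalues of its distance matrix $D(G)$, and let $I_D^1(G)$, $I_\alpha^2(G)$, $I_\alpha^3(G)$ be the generalized graph entropies formed from $\mu_1,\dots,\mu_n$. Then for every real $\alpha\ne1$: (i) $I_D^1(G)=1-\frac{4}{DE^2(G)}\left(2WW(G)-W(G)\right)$; (ii) $I_\alpha^2(G)=\frac{1}{1-\alpha}\log\frac{M_\alpha^*}{DE^\alpha(G)}$; (iii) $I_\alpha^3(G)=\frac{1}{2^{1-\alpha}-1}\left(\frac{M_\alpha^*}{DE^\alpha(G)}-1\right)$, where $M_\alpha^*=\sum_{i=1}^n|\mu_i|^\alpha$, $DE(G)$ is the distance energy of $G$ with $DE^\alpha(G)=(DE(G))^\alpha$, and $W(G)$, $WW(G)$ are the Wiener index and hyper-Wiener index of $G$ in the normalization given in the context.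
   Context: Graphs are finite and simple. The distance matrix of a connected graph $G$ with vertices $v_1,\dots,v_n$ is $D(G)=[d_{ij}]$, where $d_{ij}$ is the distance between $v_i$ and $v_j$. The distance energy is $DE(G)=\sum_{i=1}^n|\mu_i|$. The $k$-th distance moment is defined, with the paper's normalization, as $W_k(G)=\frac12\sum_{1\le i<j\le n}(d_{ij})^k$; the Wiener index is $W(G)=W_1(G)$ and the hyper-Wiener index is $WW(G)=\frac12\left(W_2(G)+W_1(G)\right)$. (Note the factor $\frac12$ together with the sum over $i<j$.) For numbers $\mu_1,\dots,\mu_n$ (listed with multiplicity) with $\sum_j|\mu_j|\neq 0$, put $p_i=|\mu_i|/\sum_{j=1}^n|\mu_j|$. The generalized graph entropies formed from $\mu_1,\dots,\mu_n$ are $I^1=\sum_{i=1}^n p_i(1-p_i)$, $\quad I^2_\alpha=\frac{1}{1-\alpha}\log\left(\sum_{i=1}^n p_i^\alpha\right)$, $\quad I^3_\alpha=\frac{\sum_{i=1}^n p_i^\alpha-1}{2^{1-\alpha}-1}$ for $\alpha\ne1$ (real $\alpha$ for which the occurring powers are defined). Here $\log$ is the logarithm to one fixed base greater than $1$. The subscript on $I^1$ names the matrix used. *)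

theory Defs
  imports
    Complex_Main
    "HOL-Computational_Algebra.Polynomial"
    "Graph_Theory.Graph_Theory"
    "Jordan_Normal_Form.Char_Poly"
begin

text \<open>
  A finite simple graph is a symmetric, loop-free digraph without parallel arcs (locale
  \<^locale>\<open>graph\<close>), so every undirected edge is represented by two opposite arcs. An edge is
  recovered as the set of its two ends.
\<close>

definition graph_edges :: "('a, 'b) pre_digraph \<Rightarrow> 'a set set" where
  "graph_edges G = (\<lambda>e. {tail G e, head G e}) ` arcs G"

definition graph_dist :: "('a, 'b) pre_digraph \<Rightarrow> 'a \<Rightarrow> 'a \<Rightarrow> nat" where
  "graph_dist G u v = (LEAST k. \<exists>p. pre_digraph.awalk G u p v \<and> length p = k)"

text \<open>
  In the following, \<open>vs\<close> is an enumeration \<open>v\<^sub>1, \<dots>, v\<^sub>n\<close> of the vertices without repetition;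
  list indices start at 0.
\<close>

definition distance_matrix :: "('a, 'b) pre_digraph \<Rightarrow> 'a list \<Rightarrow> real mat" where
  "distance_matrix G vs =
     mat (length vs) (length vs) (\<lambda>(i, j). real (graph_dist G (vs ! i) (vs ! j)))"

text \<open>
  The eigenvalues of the distance matrix with their (algebraic) multiplicities. The matrix is real
  symmetric, so no eigenvalue is lost by taking real roots; see \<open>size_distance_eigenvalues\<close> below.
\<close>

definition distance_eigenvalues :: "('a, 'b) pre_digraph \<Rightarrow> 'a list \<Rightarrow> real multiset" where
  "distance_eigenvalues G vs = proots (char_poly (distance_matrix G vs))"

definition distance_energy :: "('a, 'b) pre_digraph \<Rightarrow> 'a list \<Rightarrow> real" where
  "distance_energy G vs = (\<Sum>x\<in>#distance_eigenvalues G vs. \<bar>x\<bar>)"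

text \<open>
  The moments carry a factor \<open>1/2\<close> in addition to the restriction to \<open>i < j\<close>, so the Wiener index
  below is half of the usual one.
\<close>

definition distance_moment :: "nat \<Rightarrow> ('a, 'b) pre_digraph \<Rightarrow> 'a list \<Rightarrow> real" where
  "distance_moment k G vs =
     1 / 2 * (\<Sum>(i, j) | i < j \<and> j < length vs. real (graph_dist G (vs ! i) (vs ! j)) ^ k)"

definition wiener_index :: "('a, 'b) pre_digraph \<Rightarrow> 'a list \<Rightarrow> real" where
  "wiener_index G vs = distance_moment 1 G vs"

definition hyper_wiener_index :: "('a, 'b) pre_digraph \<Rightarrow> 'a list \<Rightarrow> real" where
  "hyper_wiener_index G vs = 1 / 2 * (distance_moment 2 G vs + distance_moment 1 G vs)"

text \<open>
  Generalized graph entropies formed from a list of numbers. Real powers are \<open>(powr)\<close>,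
  which sets \<open>0 powr a = 0\<close> for every \<open>a\<close>, including \<open>a \<le> 0\<close>. The parameter \<open>b\<close> is the base of the logarithm.
\<close>

definition entropy_prob :: "real list \<Rightarrow> nat \<Rightarrow> real" where
  "entropy_prob \<mu> i = \<bar>\<mu> ! i\<bar> / (\<Sum>j<length \<mu>. \<bar>\<mu> ! j\<bar>)"

definition entropy1 :: "real list \<Rightarrow> real" where
  "entropy1 \<mu> = (\<Sum>i<length \<mu>. entropy_prob \<mu> i * (1 - entropy_prob \<mu> i))"

definition entropy2 :: "real \<Rightarrow> real \<Rightarrow> real list \<Rightarrow> real" where
  "entropy2 b \<alpha> \<mu> = 1 / (1 - \<alpha>) * log b (\<Sum>i<length \<mu>. entropy_prob \<mu> i powr \<alpha>)"

definition entropy3 :: "real \<Rightarrow> real list \<Rightarrow> real" where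
  "entropy3 \<alpha> \<mu> = ((\<Sum>i<length \<mu>. entropy_prob \<mu> i powr \<alpha>) - 1) / (2 powr (1 - \<alpha>) - 1)"

definition abs_power_sum :: "real \<Rightarrow> real list \<Rightarrow> real" where
  "abs_power_sum \<alpha> \<mu> = (\<Sum>i<length \<mu>. \<bar>\<mu> ! i\<bar> powr \<alpha>)"

lemma awalk_reverse:
  assumes "graph G" "pre_digraph.awalk G u p v"
  shows "\<exists>q. pre_digraph.awalk G v q u \<and> length q = length p"
proof -
  interpret graph G by fact
  show ?thesis using assms(2)
  proof (induction p arbitrary: u)
    case Nil
    then show ?case by (auto simp: awalk_Nil_iff intro!: exI[of _ "[]"])
  next
    case (Cons e p)
    then have e: "e \<in> arcs G" "u = tail G e" and w: "awalk (head G e) p v"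
      by (auto simp: awalk_Cons_iff)
    from Cons.IH[OF w] obtain q where q: "awalk v q (head G e)" "length q = length p" by auto
    have "(tail G e, head G e) \<in> arcs_ends G"
      using e by (auto simp: arcs_ends_def arc_to_ends_def)
    then have "(head G e, tail G e) \<in> arcs_ends G"
      using sym_arcs by (auto simp: symmetric_def sym_def)
    then obtain e' where e': "e' \<in> arcs G" "tail G e' = head G e" "head G e' = tail G e"
      by (auto simp: arcs_ends_def arc_to_ends_def)
    have "awalk (head G e) [e'] (tail G e)"
      using e e' by (auto simp: awalk_Cons_iff awalk_Nil_iff)
    with q have "awalk v (q @ [e']) (tail G e)" by (auto intro: awalk_appendI)
    with q e show ?case by (intro exI[of _ "q @ [e']"]) auto
  qed
qed

lemma graph_dist_commute:
  assumes "graph G"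
  shows "graph_dist G u v = graph_dist G v u"
proof -
  have "(\<exists>p. pre_digraph.awalk G u p v \<and> length p = k) \<longleftrightarrow>
        (\<exists>p. pre_digraph.awalk G v p u \<and> length p = k)" for k
    using awalk_reverse[OF assms] by metis
  then show ?thesis by (simp add: graph_dist_def)
qed

lemma real_symmetric_eigenvalue_real:
  fixes A :: "real mat"
  assumes A: "A \<in> carrier_mat n n"
    and sym: "\<And>i j. i < n \<Longrightarrow> j < n \<Longrightarrow> A $$ (i, j) = A $$ (j, i)"
    and ev: "eigenvalue (map_mat complex_of_real A) z"
  shows "z \<in> \<real>"
proof -
  let ?B = "map_mat complex_of_real A"
  from ev A obtain v where v: "v \<in> carrier_vec n" "v \<noteq> 0\<^sub>v n" "?B *\<^sub>v v = z \<cdot>\<^sub>v v"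
    unfolding eigenvalue_def eigenvector_def by auto
  have comp: "(\<Sum>j<n. complex_of_real (A $$ (i, j)) * v $ j) = z * v $ i" if "i < n" for i
  proof -
    have "(?B *\<^sub>v v) $ i = (z \<cdot>\<^sub>v v) $ i" using v by simp
    moreover have "(?B *\<^sub>v v) $ i = (\<Sum>j<n. complex_of_real (A $$ (i, j)) * v $ j)"
      using that A carrier_vecD[OF v(1)] by (auto simp: scalar_prod_def atLeast0LessThan)
    ultimately show ?thesis using that carrier_vecD[OF v(1)] by simp
  qed
  define N where "N = (\<Sum>i<n. cnj (v $ i) * v $ i)"
  have N: "N = complex_of_real (\<Sum>i<n. (cmod (v $ i))\<^sup>2)"
    unfolding N_def of_real_sum
    by (intro sum.cong refl) (metis complex_norm_square mult.commute)
  obtain i where i: "i < n" "v $ i \<noteq> 0"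
    using v by (metis carrier_vecD eq_vecI index_zero_vec(1) index_zero_vec(2))
  have "(\<Sum>i<n. (cmod (v $ i))\<^sup>2) > 0"
    using i by (intro sum_pos2[of _ i]) auto
  then have N0: "N \<noteq> 0" unfolding N of_real_eq_0_iff by simp
  define S where "S = (\<Sum>i<n. \<Sum>j<n. cnj (v $ i) * (complex_of_real (A $$ (i, j)) * v $ j))"
  have S: "S = z * N"
  proof -
    have "S = (\<Sum>i<n. cnj (v $ i) * (\<Sum>j<n. complex_of_real (A $$ (i, j)) * v $ j))"
      unfolding S_def by (simp add: sum_distrib_left)
    also have "\<dots> = (\<Sum>i<n. cnj (v $ i) * (z * v $ i))"
      by (intro sum.cong refl) (simp add: comp)
    also have "\<dots> = z * N"
      unfolding N_def sum_distrib_left by (intro sum.cong refl) (simp add: mult_ac)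
    finally show ?thesis .
  qed
  have "cnj S = (\<Sum>i<n. \<Sum>j<n. cnj (v $ j) * (complex_of_real (A $$ (i, j)) * v $ i))"
    unfolding S_def by (simp add: algebra_simps)
  also have "\<dots> = (\<Sum>j<n. \<Sum>i<n. cnj (v $ j) * (complex_of_real (A $$ (i, j)) * v $ i))"
    by (rule sum.swap)
  also have "\<dots> = S"
    unfolding S_def by (intro sum.cong refl) (simp add: sym)
  finally have "cnj (z * N) = z * N" unfolding S .
  moreover have "cnj N = N" unfolding N by simp
  ultimately have "cnj z = z" using N0 by simp
  then show ?thesis by (simp add: Reals_cnj_iff)
qed

lemma size_proots_char_poly_symmetric:
  fixes A :: "real mat"
  assumes A: "A \<in> carrier_mat n n"
    and sym: "\<And>i j. i < n \<Longrightarrow> j < n \<Longrightarrow> A $$ (i, j) = A $$ (j, i)"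
  shows "size (proots (char_poly A)) = n"
proof -
  interpret h: map_poly_comm_ring_hom complex_of_real ..
  let ?B = "map_mat complex_of_real A"
  have B: "?B \<in> carrier_mat n n" using A by simp
  from char_poly_factorized[OF B] obtain as where
    as: "char_poly ?B = (\<Prod>a\<leftarrow>as. [:- a, 1:])" "length as = n" by blast
  have "a \<in> \<real>" if "a \<in> set as" for a
  proof (rule real_symmetric_eigenvalue_real[OF A sym])
    have "poly (char_poly ?B) a = 0"
      unfolding as poly_prod_list using that by (auto simp: prod_list_zero_iff o_def image_iff)
    then show "eigenvalue ?B a" using eigenvalue_root_char_poly[OF B] by simp
  qed auto
  then have asr: "as = map complex_of_real (map Re as)"
    by (auto simp: map_idI of_real_Re)
  have hom: "map_poly complex_of_real (\<Prod>a\<leftarrow>xs. [:- a, 1:]) =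
      (\<Prod>a\<leftarrow>map complex_of_real xs. [:- a, 1:])" for xs
  proof (induction xs)
    case (Cons x xs)
    have "map_poly complex_of_real ([:- x, 1:] * (\<Prod>a\<leftarrow>xs. [:- a, 1:])) =
        map_poly complex_of_real [:- x, 1:] * map_poly complex_of_real (\<Prod>a\<leftarrow>xs. [:- a, 1:])"
      by (rule h.hom_mult)
    with Cons show ?case by (simp add: map_poly_pCons)
  qed simp
  have "map_poly complex_of_real (char_poly A) = char_poly ?B"
    by (rule of_real_hom.char_poly_hom[OF A, symmetric])
  also have "\<dots> = map_poly complex_of_real (\<Prod>a\<leftarrow>map Re as. [:- a, 1:])"
    unfolding as(1) by (subst asr) (rule hom[symmetric])
  finally have "char_poly A = (\<Prod>a\<leftarrow>map Re as. [:- a, 1:])"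
    by (simp only: poly_eq_iff coeff_map_poly of_real_0 of_real_eq_iff simp_thms)
  moreover have "size (proots (\<Prod>a\<leftarrow>xs. [:- a, 1:])) = length xs" for xs :: "real list"
  proof (induction xs)
    case (Cons x xs)
    have "(\<Prod>a\<leftarrow>xs. [:- a, 1:]) \<noteq> 0" by (auto simp: prod_list_zero_iff)
    then have "proots ([:- x, 1:] * (\<Prod>a\<leftarrow>xs. [:- a, 1:])) =
        proots [:- x, 1:] + proots (\<Prod>a\<leftarrow>xs. [:- a, 1:])"
      by (intro proots_mult) auto
    with Cons show ?case by (simp del: mult_pCons_left)
  qed simp
  ultimately show ?thesis using as(2) by (simp only: length_map)
qed

lemma size_distance_eigenvalues:
  assumes "graph G"
  shows "size (distance_eigenvalues G vs) = length vs"
  unfolding distance_eigenvalues_def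
  by (rule size_proots_char_poly_symmetric)
     (auto simp: distance_matrix_def graph_dist_commute[OF assms])

end

theory Submission
  imports Defs "Jordan_Normal_Form.Schur_Decomposition"
begin

text \<open>
  Write \<open>E = \<Sum>\<^sub>j \<bar>\<mu>\<^sub>j\<bar>\<close> for the energy. The formulas for \<open>I\<^sup>2\<close> and \<open>I\<^sup>3\<close> only say that the factor
  \<open>1 / E powr \<alpha>\<close> can be pulled out of \<open>\<Sum>\<^sub>i p\<^sub>i powr \<alpha>\<close>. The formula for \<open>I\<^sup>1\<close> carries the content.
  If \<open>E \<noteq> 0\<close>, the \<open>p\<^sub>i\<close> sum to 1, so \<open>I\<^sup>1 = 1 - (\<Sum>\<^sub>i \<mu>\<^sub>i\<^sup>2) / E\<^sup>2\<close>. The sum of the squared eigenvalues is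
  the trace of \<open>D\<^sup>2\<close>, because \<open>D\<close> is similar to a triangular matrix with the eigenvalues on its
  diagonal (Schur), and the trace is invariant under similarity. As \<open>D\<close> is symmetric with zero
  diagonal, that trace counts every \<open>d\<^sub>i\<^sub>j\<^sup>2\<close> with \<open>i < j\<close> twice, which is four times the halved
  moment \<open>W\<^sub>2 = 2 WW - W\<close>.

  Finally \<open>E \<noteq> 0\<close>: otherwise all eigenvalues vanish, hence so does \<open>W\<^sub>2\<close>, although in a connected graph
  two distinct vertices are at positive distance.
\<close>

section \<open>Trace and eigenvalues\<close>

definition mat_trace :: "'a::comm_ring_1 mat \<Rightarrow> 'a" where
  "mat_trace A = (\<Sum>i<dim_row A. A $$ (i, i))"

lemma index_mult_mat_sum:
  assumes "A \<in> carrier_mat n k" "B \<in> carrier_mat k m" "i < n" "j < m"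
  shows "(A * B) $$ (i, j) = (\<Sum>l<k. A $$ (i, l) * B $$ (l, j))"
  using assms by (auto simp: scalar_prod_def atLeast0LessThan)

lemma mat_trace_mult:
  assumes "A \<in> carrier_mat n k" "B \<in> carrier_mat k n"
  shows "mat_trace (A * B) = (\<Sum>i<n. \<Sum>l<k. A $$ (i, l) * B $$ (l, i))"
  using assms by (simp add: mat_trace_def index_mult_mat_sum[OF assms] del: index_mult_mat(1))

lemma mat_trace_mult_commute:
  assumes "A \<in> carrier_mat n k" "B \<in> carrier_mat k n"
  shows "mat_trace (A * B) = mat_trace (B * A)"
  unfolding mat_trace_mult[OF assms] mat_trace_mult[OF assms(2,1)]
  by (subst sum.swap) (simp add: mult.commute)

lemma mat_trace_similar:
  assumes "similar_mat_wit A B P Q"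
  shows "mat_trace A = mat_trace B"
proof -
  note wit = similar_mat_witD[OF refl assms]
  have "mat_trace A = mat_trace (P * B * Q)" using wit(3) by simp
  also have "\<dots> = mat_trace (Q * (P * B))"
    using wit(5-7) by (intro mat_trace_mult_commute) auto
  also have "Q * (P * B) = Q * P * B"
    using wit(5-7) by (intro assoc_mult_mat[symmetric]) auto
  also have "\<dots> = B"
    unfolding wit(2) using wit(5) by simp
  finally show ?thesis .
qed

text \<open>
  In a product of two upper triangular matrices, the only term that survives on the diagonal is the
  product of the two diagonal entries.
\<close>

lemma mat_trace_square_upper_triangular:
  assumes B: "B \<in> carrier_mat n n" and ut: "upper_triangular B"
  shows "mat_trace (B * B) = (\<Sum>x\<leftarrow>diag_mat B. x\<^sup>2)"
proof -
  have "(\<Sum>l<n. B $$ (i, l) * B $$ (l, i)) = (B $$ (i, i))\<^sup>2" if i: "i < n" for i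
  proof -
    have "B $$ (i, l) * B $$ (l, i) = (if l = i then (B $$ (i, i))\<^sup>2 else 0)" if "l < n" for l
      using upper_triangularD[OF ut, of l i] upper_triangularD[OF ut, of i l] B i that
      by (cases l i rule: linorder_cases) (auto simp: power2_eq_square)
    then have "(\<Sum>l<n. B $$ (i, l) * B $$ (l, i)) = (\<Sum>l<n. if l = i then (B $$ (i, i))\<^sup>2 else 0)"
      by (intro sum.cong) auto
    then show ?thesis using i by simp
  qed
  then have "mat_trace (B * B) = (\<Sum>i<n. (B $$ (i, i))\<^sup>2)"
    using mat_trace_mult[OF B B] by simp
  also have "\<dots> = (\<Sum>x\<leftarrow>diag_mat B. x\<^sup>2)"
    using B by (simp add: diag_mat_def interv_sum_list_conv_sum_set_nat o_def atLeast0LessThan)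
  finally show ?thesis .
qed

text \<open>
  A polynomial that has as many roots as its degree allows is the product of its linear factors;
  dividing out one listed root at a time leaves a polynomial of the same kind.
\<close>

lemma monic_eq_prod_list_proots:
  fixes p :: "'a::field poly"
  assumes "mset xs = proots p" "degree p = length xs" "lead_coeff p = 1"
  shows "p = (\<Prod>a\<leftarrow>xs. [:- a, 1:])"
  using assms
proof (induction xs arbitrary: p)
  case Nil
  then show ?case by (auto elim!: degree_eq_zeroE)
next
  case (Cons x xs)
  have p0: "p \<noteq> 0" using Cons.prems by auto
  have "x \<in># proots p" using Cons.prems(1) by (metis list.set_intros(1) set_mset_mset)
  then have "poly p x = 0" using p0 by simp
  then obtain q where q: "p = [:- x, 1:] * q" by (auto simp: poly_eq_0_iff_dvd)
  have q0: "q \<noteq> 0" using p0 q by auto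
  have "proots p = {#x#} + proots q"
    unfolding q using q0 by (subst proots_mult) auto
  then have 1: "mset xs = proots q" using Cons.prems(1) by simp
  have "degree p = Suc (degree q)" unfolding q using q0 by (subst degree_mult_eq) auto
  then have 2: "degree q = length xs" using Cons.prems(2) by simp
  have 3: "lead_coeff q = 1"
    using Cons.prems(3) unfolding q lead_coeff_mult by simp
  show ?case using Cons.IH[OF 1 2 3] q by simp
qed

text \<open>
  Schur's theorem gives a triangular matrix similar to \<open>A\<close>, and the same similarity takes \<open>A\<^sup>2\<close> to the
  square of that matrix. The hypothesis \<open>length es = n\<close> says that the characteristic polynomial splits
  over the reals, so that the triangular form exists without passing to complex numbers.
\<close>

lemma sum_list_square_eigenvalues:
  fixes A :: "real mat"
  assumes A: "A \<in> carrier_mat n n"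
    and es: "mset es = proots (char_poly A)" "length es = n"
  shows "(\<Sum>x\<leftarrow>es. x\<^sup>2) = mat_trace (A * A)"
proof -
  have cp: "char_poly A = (\<Prod>a\<leftarrow>es. [:- a, 1:])"
    using es degree_monic_char_poly[OF A] by (intro monic_eq_prod_list_proots) auto
  obtain B P Q where BPQ: "schur_decomposition A es = (B, P, Q)"
    by (cases "schur_decomposition A es")
  from schur_decomposition[OF A cp BPQ]
  have sim: "similar_mat_wit A B P Q" and ut: "upper_triangular B" and diag: "diag_mat B = es"
    by auto
  have B: "B \<in> carrier_mat n n" using sim A by (auto simp: similar_mat_wit_def Let_def)
  have "similar_mat_wit (A ^\<^sub>m 2) (B ^\<^sub>m 2) P Q" by (rule similar_mat_wit_pow[OF sim])
  then have "similar_mat_wit (A * A) (B * B) P Q"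
    using A B by (simp add: numeral_2_eq_2)
  then show ?thesis
    using mat_trace_similar mat_trace_square_upper_triangular[OF B ut] diag by metis
qed

section \<open>Distances and the second moment\<close>

lemma graph_dist_self:
  assumes "graph G" "u \<in> verts G"
  shows "graph_dist G u u = 0"
proof -
  interpret graph G by fact
  show ?thesis unfolding graph_dist_def
    using assms(2) by (intro Least_eq_0 exI[of _ "[]"]) (auto simp: awalk_Nil_iff)
qed

text \<open>
  Connectedness ensures that the least length is attained by a walk, and a walk of length 0 does not
  leave its start.
\<close>

lemma graph_dist_pos:
  assumes "graph G" "Digraph_Component.connected G" "u \<in> verts G" "v \<in> verts G" "u \<noteq> v"
  shows "graph_dist G u v > 0"
proof -
  interpret graph G by fact
  have "u \<rightarrow>\<^sup>*\<^bsub>mk_symmetric G\<^esub> v"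
    using assms by (auto simp: connected_def strongly_connected_def)
  then have "u \<rightarrow>\<^sup>*\<^bsub>G\<^esub> v" using reachable_mk_symmetric_eq[OF sym_arcs] by simp
  then obtain p where "awalk u p v" by (auto simp: reachable_awalk)
  then have "\<exists>k p. awalk u p v \<and> length p = k" by blast
  from LeastI_ex[OF this] obtain q where "awalk u q v" "length q = graph_dist G u v"
    unfolding graph_dist_def by blast
  then show ?thesis using assms(5) by (cases q) (auto simp: awalk_Nil_iff)
qed

lemma sum_symmetric_zero_diagonal:
  fixes f :: "nat \<Rightarrow> nat \<Rightarrow> 'a::comm_semiring_1"
  assumes sym: "\<And>i j. i < n \<Longrightarrow> j < n \<Longrightarrow> f i j = f j i" and diag: "\<And>i. i < n \<Longrightarrow> f i i = 0"
  shows "(\<Sum>i<n. \<Sum>j<n. f i j) = 2 * (\<Sum>(i, j) | i < j \<and> j < n. f i j)"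
proof -
  define U where "U = {(i, j). i < j \<and> j < n}"
  define L where "L = {(i, j). j < i \<and> i < n}"
  define I where "I = {(i, j). i = j \<and> j < n}"
  have fin: "finite U" "finite L" "finite I"
    by (rule finite_subset[of _ "{..<n} \<times> {..<n}"]; auto simp: U_def L_def I_def)+
  have "(\<Sum>i<n. \<Sum>j<n. f i j) = (\<Sum>(i, j)\<in>U \<union> L \<union> I. f i j)"
    unfolding sum.cartesian_product
    by (rule sum.cong) (auto simp: U_def L_def I_def)
  also have "\<dots> = (\<Sum>(i, j)\<in>U. f i j) + (\<Sum>(i, j)\<in>L. f i j) + (\<Sum>(i, j)\<in>I. f i j)"
    using fin by (subst sum.union_disjoint; (subst sum.union_disjoint)?)
      (auto simp: U_def L_def I_def)
  also have "(\<Sum>(i, j)\<in>I. f i j) = 0"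
    by (rule sum.neutral) (auto simp: I_def diag)
  also have "(\<Sum>(i, j)\<in>L. f i j) = (\<Sum>(i, j)\<in>U. f i j)"
    by (rule sum.reindex_bij_witness[of _ prod.swap prod.swap])
       (auto simp: U_def L_def intro: sym)
  finally show ?thesis by (simp add: U_def mult_2)
qed

lemma sum_list_square_distance_eigenvalues:
  assumes G: "graph G" and vs: "set vs \<subseteq> verts G"
    and \<mu>: "mset \<mu> = distance_eigenvalues G vs"
  shows "(\<Sum>x\<leftarrow>\<mu>. x\<^sup>2) = 4 * distance_moment 2 G vs"
proof -
  let ?D = "distance_matrix G vs" and ?n = "length vs"
  let ?d = "\<lambda>i j. real (graph_dist G (vs ! i) (vs ! j))"
  have D: "?D \<in> carrier_mat ?n ?n" by (simp add: distance_matrix_def)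
  have "length \<mu> = ?n" using size_distance_eigenvalues[OF G, of vs] \<mu> by (metis size_mset)
  then have "(\<Sum>x\<leftarrow>\<mu>. x\<^sup>2) = mat_trace (?D * ?D)"
    using \<mu> by (intro sum_list_square_eigenvalues[OF D]) (simp_all add: distance_eigenvalues_def)
  also have "\<dots> = (\<Sum>i<?n. \<Sum>j<?n. ?d i j ^ 2)"
    unfolding mat_trace_mult[OF D D]
    by (intro sum.cong refl)
       (simp add: distance_matrix_def power2_eq_square graph_dist_commute[OF G])
  also have "\<dots> = 2 * (\<Sum>(i, j) | i < j \<and> j < ?n. ?d i j ^ 2)"
    using vs by (intro sum_symmetric_zero_diagonal)
      (auto simp: graph_dist_commute[OF G] graph_dist_self[OF G] subset_iff)
  finally show ?thesis by (simp add: distance_moment_def)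
qed

lemma distance_moment_pos:
  assumes G: "graph G" "Digraph_Component.connected G"
    and vs: "distinct vs" "set vs \<subseteq> verts G" "length vs \<ge> 2"
  shows "distance_moment k G vs > 0"
proof -
  have "vs \<noteq> []" using vs(3) by auto
  have "vs ! 0 \<noteq> vs ! 1" using vs by (subst nth_eq_iff_index_eq) auto
  then have "graph_dist G (vs ! 0) (vs ! 1) > 0"
    using vs \<open>vs \<noteq> []\<close> by (intro graph_dist_pos[OF G]) auto
  moreover have "finite {(i, j). i < j \<and> j < length vs}"
    by (rule finite_subset[of _ "{..<length vs} \<times> {..<length vs}"]) auto
  ultimately show ?thesis
    unfolding distance_moment_def using vs(3)
    by (intro mult_pos_pos sum_pos2[of _ "(0, 1)"]) auto
qed

section \<open>Entropies in terms of power sums\<close>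

lemma entropy1_eq:
  assumes "(\<Sum>x\<leftarrow>\<mu>. \<bar>x\<bar>) \<noteq> 0"
  shows "entropy1 \<mu> = 1 - (\<Sum>x\<leftarrow>\<mu>. x\<^sup>2) / (\<Sum>x\<leftarrow>\<mu>. \<bar>x\<bar>)\<^sup>2"
proof -
  let ?E = "\<Sum>j<length \<mu>. \<bar>\<mu> ! j\<bar>"
  have E: "(\<Sum>x\<leftarrow>\<mu>. \<bar>x\<bar>) = ?E"
    by (simp add: sum_list_sum_nth atLeast0LessThan)
  have "entropy1 \<mu> = (\<Sum>i<length \<mu>. \<bar>\<mu> ! i\<bar> / ?E - (\<mu> ! i)\<^sup>2 / ?E\<^sup>2)"
    unfolding entropy1_def entropy_prob_def
    by (intro sum.cong refl) (simp add: right_diff_distrib power2_eq_square)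
  also have "\<dots> = ?E / ?E - (\<Sum>i<length \<mu>. (\<mu> ! i)\<^sup>2) / ?E\<^sup>2"
    by (simp add: sum_subtractf flip: sum_divide_distrib)
  also have "?E / ?E = 1" using assms E by simp
  finally show ?thesis unfolding E
    by (simp add: sum_list_sum_nth atLeast0LessThan)
qed

lemma sum_entropy_prob_powr:
  "(\<Sum>i<length \<mu>. entropy_prob \<mu> i powr \<alpha>) = abs_power_sum \<alpha> \<mu> / (\<Sum>x\<leftarrow>\<mu>. \<bar>x\<bar>) powr \<alpha>"
  unfolding abs_power_sum_def entropy_prob_def
  by (simp add: powr_divide sum_nonneg sum_divide_distrib sum_list_sum_nth atLeast0LessThan)

theorem theorem3p7:
  fixes G :: "('a, 'b) pre_digraph" and vs :: "'a list" and n m :: nat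
    and \<mu> :: "real list" and b \<alpha> :: real
  assumes "graph G" and "Digraph_Component.connected G"
    and "distinct vs" and "set vs = verts G"
    and "n = card (verts G)" and "n \<ge> 2" and "m = card (graph_edges G)"
    and "mset \<mu> = distance_eigenvalues G vs"
    and "b > 1" and "\<alpha> \<noteq> 1"
  shows "entropy1 \<mu> = 1 - 4 / (distance_energy G vs)\<^sup>2 * (2 * hyper_wiener_index G vs - wiener_index G vs) \<and>
     entropy2 b \<alpha> \<mu> = 1 / (1 - \<alpha>) * log b (abs_power_sum \<alpha> \<mu> / distance_energy G vs powr \<alpha>) \<and>
     entropy3 \<alpha> \<mu> = 1 / (2 powr (1 - \<alpha>) - 1) * (abs_power_sum \<alpha> \<mu> / distance_energy G vs powr \<alpha> - 1)"
proof -
  have len: "length vs \<ge> 2"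
    using distinct_card[OF \<open>distinct vs\<close>] \<open>set vs = verts G\<close> \<open>n = card (verts G)\<close> \<open>n \<ge> 2\<close> by simp
  have sq: "(\<Sum>x\<leftarrow>\<mu>. x\<^sup>2) = 4 * distance_moment 2 G vs"
    using assms by (intro sum_list_square_distance_eigenvalues) auto
  have E: "(\<Sum>x\<leftarrow>\<mu>. \<bar>x\<bar>) = distance_energy G vs"
    unfolding distance_energy_def \<open>mset \<mu> = distance_eigenvalues G vs\<close>[symmetric]
    by (metis mset_map sum_mset_sum_list)
  have "(\<Sum>x\<leftarrow>\<mu>. \<bar>x\<bar>) \<noteq> 0"
  proof
    assume "(\<Sum>x\<leftarrow>\<mu>. \<bar>x\<bar>) = 0"
    then have "\<forall>x\<in>set \<mu>. x = 0"
      by (subst (asm) sum_list_nonneg_eq_0_iff) auto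
    then have "(\<Sum>x\<leftarrow>\<mu>. x\<^sup>2) = 0" by (induction \<mu>) auto
    then show False
      using sq distance_moment_pos[of G vs 2] assms len by simp
  qed
  then have 1: "entropy1 \<mu> = 1 - 4 * distance_moment 2 G vs / (distance_energy G vs)\<^sup>2"
    using entropy1_eq sq E by simp
  have "2 * hyper_wiener_index G vs - wiener_index G vs = distance_moment 2 G vs"
    by (simp add: hyper_wiener_index_def wiener_index_def field_simps)
  with 1 have "entropy1 \<mu> =
      1 - 4 / (distance_energy G vs)\<^sup>2 * (2 * hyper_wiener_index G vs - wiener_index G vs)"
    by simp
  then show ?thesis
    by (simp add: entropy2_def entropy3_def sum_entropy_prob_powr E)
qed

end
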